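(* Let $\mathcal{H}$ be a complex Hilbert space and let $A,B\in L(\mathcal{H})$. The following statements are equivalent: (1) $A$ is below $A+B$ in the left minus order, i.e. $R(A+B)=R(A)\dotplus R(B)$; (2) Given $a\in R(A)$ and $b\in R(B)$, the equation $(A+B)x=a+b$ has a solution $x_0\in\mathcal{H}$. Moreover, $x_0$ is a solution of the system $Ax=a$, $Bx=b$.
   Context: $L(\mathcal{H})$ is the algebra of bounded linear operators on $\mathcal{H}$, $R(T)$ is the range of $T$, and $\dotplus$ denotes a direct (algebraic) sum of linear subspaces (trivial intersection). For $A,C\in L(\mathcal{H})$, $A$ is below $C$ in the left minus order if and only if $R(C)=R(A)\dotplus R(C-A)$. *)

theory Defs
  imports "HOL-Analysis.Analysis"
begin

class complex_inner = real_normed_vector +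
  fixes scaleC :: "complex \<Rightarrow> 'a \<Rightarrow> 'a"  (infixr "*\<^sub>C" 75)
    and cinner :: "'a \<Rightarrow> 'a \<Rightarrow> complex"
  assumes scaleC_add_right: "c *\<^sub>C (x + y) = c *\<^sub>C x + c *\<^sub>C y"
    and scaleC_add_left: "(c + d) *\<^sub>C x = c *\<^sub>C x + d *\<^sub>C x"
    and scaleC_scaleC: "c *\<^sub>C d *\<^sub>C x = (c * d) *\<^sub>C x"
    and scaleC_of_real: "complex_of_real r *\<^sub>C x = r *\<^sub>R x"
    and cinner_commute: "cinner x y = cnj (cinner y x)"
    and cinner_add_left: "cinner (x + y) z = cinner x z + cinner y z"
    and cinner_scaleC_left: "cinner (c *\<^sub>C x) y = c * cinner x y"
    and cinner_ge_zero: "0 \<le> Re (cinner x x)"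
    and cinner_eq_zero_iff: "cinner x x = 0 \<longleftrightarrow> x = 0"
    and norm_eq_sqrt_cinner: "norm x = sqrt (Re (cinner x x))"

class complex_hilbert_space = complex_inner + complete_space

instantiation complex :: complex_hilbert_space
begin

definition scaleC_complex :: "complex \<Rightarrow> complex \<Rightarrow> complex" where
  "scaleC_complex c x = c * x"

definition cinner_complex :: "complex \<Rightarrow> complex \<Rightarrow> complex" where
  "cinner_complex x y = x * cnj y"

instance
  by standard
    (auto simp: scaleC_complex_def cinner_complex_def algebra_simps scaleR_conv_of_real
      cmod_def power2_eq_square)

end

text \<open>An element of \<open>L(H)\<close> is a value of the library type of bounded real-linear maps that
  moreover commutes with complex scalars.\<close>

definition complex_linear :: "('a::complex_inner \<Rightarrow>\<^sub>L 'a) \<Rightarrow> bool" where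
  "complex_linear T \<longleftrightarrow> (\<forall>c x. T (c *\<^sub>C x) = c *\<^sub>C T x)"

abbreviation op_range :: "('a::complex_inner \<Rightarrow>\<^sub>L 'a) \<Rightarrow> 'a set" where
  "op_range T \<equiv> range (blinfun_apply T)"

definition is_direct_sum :: "'a::real_vector set \<Rightarrow> 'a set \<Rightarrow> 'a set \<Rightarrow> bool" where
  "is_direct_sum W U V \<longleftrightarrow> W = {u + v | u v. u \<in> U \<and> v \<in> V} \<and> U \<inter> V = {0}"

definition left_minus_le :: "('a::complex_inner \<Rightarrow>\<^sub>L 'a) \<Rightarrow> ('a \<Rightarrow>\<^sub>L 'a) \<Rightarrow> bool" where
  "left_minus_le A C \<longleftrightarrow> is_direct_sum (op_range C) (op_range A) (op_range (C - A))"

end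

theory Submission
  imports Defs
begin

text \<open>The argument is linear algebra of two linear maps, carried by
  \<open>is_direct_sum_range_add_iff\<close>. Two decompositions \<open>A x + B x = a + b\<close>
  differ by a vector lying in both ranges, so trivial intersection forces them to agree. Conversely,
  a common vector \<open>v\<close> of the ranges gives the decomposition
  \<open>0 = v + (- v)\<close>; since \<open>x = 0\<close> solves the corresponding equation, it
  must split it as prescribed, hence \<open>v = 0\<close>. Solvability for all \<open>a\<close>,
  \<open>b\<close> says that the range of the sum contains the sum of the ranges.\<close>

lemma is_direct_sum_range_add_iff:
  fixes A B :: "'a::real_vector \<Rightarrow> 'b::real_vector"
  assumes A: "linear A" and B: "linear B"
  shows "is_direct_sum (range (\<lambda>x. A x + B x)) (range A) (range B) \<longleftrightarrow>
    (\<forall>a \<in> range A. \<forall>b \<in> range B.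
      (\<exists>x. A x + B x = a + b) \<and> (\<forall>x. A x + B x = a + b \<longrightarrow> A x = a \<and> B x = b))"
    (is "?sum \<longleftrightarrow> ?split")
proof
  assume sum: ?sum
  show ?split
  proof (intro ballI conjI allI impI)
    fix a b
    assume a: "a \<in> range A" and b: "b \<in> range B"
    then have "a + b \<in> range (\<lambda>x. A x + B x)"
      using sum unfolding is_direct_sum_def by blast
    then show "\<exists>x. A x + B x = a + b" by (auto dest: sym)
    fix x
    assume x: "A x + B x = a + b"
    \<comment> \<open>The left side lies in the range of \<open>A\<close>, the right side in that of
      \<open>B\<close>, as ranges of linear maps are closed under differences.\<close>
    then have eq: "A x - a = b - B x" by (simp add: algebra_simps)
    have "A x - a \<in> range A" using a by (auto simp flip: linear_diff[OF A])
    moreover have "b - B x \<in> range B" using b by (auto simp flip: linear_diff[OF B])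
    ultimately have "A x - a \<in> range A \<inter> range B" using eq by simp
    then have "A x - a = 0" using sum unfolding is_direct_sum_def by blast
    with eq show "A x = a" "B x = b" by simp_all
  qed
next
  assume split: ?split
  have "v = 0" if "v \<in> range A" "v \<in> range B" for v
  proof -
    have "- v \<in> range B" using that(2) by (auto simp flip: linear_neg[OF B])
    \<comment> \<open>The hypothesis is applied to \<open>a = v\<close>, \<open>b = - v\<close> and
      the solution \<open>x = 0\<close>.\<close>
    moreover have "A 0 + B 0 = v + - v" using linear_0[OF A] linear_0[OF B] by simp
    ultimately have "A 0 = v" using split that(1) by blast
    then show ?thesis using linear_0[OF A] by simp
  qed
  moreover have "0 \<in> range A" "0 \<in> range B"
    using rangeI[of A 0] rangeI[of B 0] linear_0[OF A] linear_0[OF B] by simp_all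
  ultimately have "range A \<inter> range B = {0}" by blast
  moreover have "range (\<lambda>x. A x + B x) = {u + v | u v. u \<in> range A \<and> v \<in> range B}"
  proof (intro equalityI subsetI)
    \<comment> \<open>Only this inclusion uses solvability; the opposite one is immediate and left
      to the closing \<open>blast\<close>.\<close>
    fix w assume "w \<in> {u + v | u v. u \<in> range A \<and> v \<in> range B}"
    then obtain u v where "w = u + v" "u \<in> range A" "v \<in> range B" by blast
    with split obtain x where "A x + B x = w" by blast
    then show "w \<in> range (\<lambda>x. A x + B x)" by blast
  qed blast
  ultimately show ?sum unfolding is_direct_sum_def by blast
qed

text \<open>The first conjunct records the reformulation of the order as a direct sum. In the
  second, the "moreover" clause is read as a claim about every solution \<open>x0\<close>, not just
  one.\<close>

theorem proposition4p11:
  fixes A B :: "'a::complex_hilbert_space \<Rightarrow>\<^sub>L 'a"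
  assumes "complex_linear A" and "complex_linear B"
  shows "(left_minus_le A (A + B) \<longleftrightarrow> is_direct_sum (op_range (A + B)) (op_range A) (op_range B)) \<and>
    (left_minus_le A (A + B) \<longleftrightarrow>
      (\<forall>a \<in> op_range A. \<forall>b \<in> op_range B.
        (\<exists>x0. (A + B) x0 = a + b) \<and>
        (\<forall>x0. (A + B) x0 = a + b \<longrightarrow> A x0 = a \<and> B x0 = b)))"
proof -
  \<comment> \<open>The order's second summand is the range of \<open>A + B - A\<close>, which
    simplifies to \<open>B\<close>.\<close>
  have "left_minus_le A (A + B) \<longleftrightarrow> is_direct_sum (op_range (A + B)) (op_range A) (op_range B)"
    by (simp add: left_minus_le_def)
  moreover have "blinfun_apply (A + B) = (\<lambda>x. A x + B x)"
    by (simp add: fun_eq_iff blinfun.add_left)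
  moreover have "linear (blinfun_apply A)" "linear (blinfun_apply B)"
    by (simp_all add: blinfun.bounded_linear_right bounded_linear.linear)
  ultimately show ?thesis
    using is_direct_sum_range_add_iff[of "blinfun_apply A" "blinfun_apply B"] by simp
qed

end
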